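(* Let $L\ge2$ and fix layer widths $d_0,\dots,d_{L-1}$, integers $K_{\ell,j}\ge1$, degrees $r^{(\ell)}_{j,k}\ge1$, exponents $\alpha_\ell>0$, and parameters $w^{(\ell)}_{j,k}\in\mathbb{R}^{d_{\ell-1}}$, $b^{(\ell)}_{j,k}\in\mathbb{R}$ for $\ell=1,\dots,L-1$. Consider the parameter-range minimization problem in the positive variables $d_{\ell,i}$ ($1\le\ell\le L-1$, $1\le i\le d_\ell$), $s^{(\ell)}_p$, $s^{(\ell)}_n$ ($1\le\ell\le L-1$) and $t$: $$\begin{aligned}\min\quad & t\\ \text{s.t.}\quad & s^{(\ell)}_p+s^{(\ell)}_n\le t,\qquad \ell=1,\dots,L-1,\\ & s^{(\ell)}_p\ge a\,\Phi_a,\qquad a\in\mathcal{P}^{(\ell)},\ \ell=1,\dots,L-1,\\ & s^{(\ell)}_n\ge(-a)\,\Phi_a,\qquad a\in\mathcal{N}^{(\ell)},\ \ell=1,\dots,L-1,\end{aligned}$$ optionally with the additional constraints $\prod_{i=1}^{d_\ell}d_{\ell,i}=1$ for $\ell=1,\dots,L-1$ and $d_{\min}\le d_{\ell,i}\le d_{\max}$ for all $\ell,i$ (with constants $0<d_{\min}\le d_{\max}$), where $\mathcal{P}^{(\ell)},\mathcal{N}^{(\ell)}$ and $\Phi_a$ are as defined in the context. Then this problem is a geometric program, and after the change of variables $u_{\ell,i}=\log d_{\ell,i}$, $\tilde s^{(\ell)}_p=\log s^{(\ell)}_p$, $\tilde s^{(\ell)}_n=\log s^{(\ell)}_n$, $\tilde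 t=\log t$ it becomes a convex optimization problem (convex objective and convex feasible set).
   Context: For each $\ell=1,\dots,L-1$, consider the family of all scalar parameters of layer $\ell$: the weight entries $w^{(\ell)}_{j,k}[p]$ ($1\le j\le d_\ell$, $1\le k\le K_{\ell,j}$, $1\le p\le d_{\ell-1}$) and the biases $b^{(\ell)}_{j,k}$ (parameters are indexed, so equal values at different positions are distinct members of the family). $\mathcal{P}^{(\ell)}$ consists of those parameters $a$ with $a\ge0$ and $\mathcal{N}^{(\ell)}$ of those with $a<0$. With $\gamma^{(\ell)}_{j,k}:=\frac{1}{\alpha_\ell r^{(\ell)}_{j,k}}$, the multiplicative factor $\Phi_a$ attached to a parameter $a$ is $$\Phi_{w^{(\ell)}_{j,k}[p]}=d_{\ell-1,p}^{-1}\,d_{\ell,j}^{\gamma^{(\ell)}_{j,k}},\qquad \Phi_{b^{(\ell)}_{j,k}}=d_{\ell,j}^{\gamma^{(\ell)}_{j,k}},$$ where $d_{0,p}:=1$ for all $p$ (no scaling at the input). A monomial in positive variables $x_1,\dots,x_n$ is a function $c\,x_1^{a_1}\cdots x_n^{a_n}$ with $c>0$, $a_i\in\mathbb{R}$; a posynomial is a finite sum of monomials (the zero function is allowed as the empty sum). A geometric program is the minimization of a posynomial over positive variables subject to constraints of the form (posynomial) $\le$ (monomial) and (monomial) $=$ (monomial). *)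

theory Defs
  imports "HOL-Analysis.Analysis" "HOL-Library.Function_Algebras"
begin

(* The number of optimization variables depends on the layer widths, so points are families
   of reals over a finite index set V, i.e. elements of V \<rightarrow>\<^sub>E UNIV.  The pointwise vector
   space structure on functions makes the library's convex and convex_on available.  Since
   u *\<^sub>R undefined + v *\<^sub>R undefined = undefined whenever u + v = 1, convex combinations of
   elements of V \<rightarrow>\<^sub>E UNIV stay in V \<rightarrow>\<^sub>E UNIV, so this is ordinary convexity in R^V. *)

instantiation "fun" :: (type, real_vector) real_vector
begin

definition scaleR_fun :: "real \<Rightarrow> ('a \<Rightarrow> 'b) \<Rightarrow> 'a \<Rightarrow> 'b"
  where "scaleR_fun c f = (\<lambda>x. c *\<^sub>R f x)"

instance
  by standard (simp_all add: scaleR_fun_def plus_fun_def fun_eq_iff scaleR_add_right scaleR_add_left)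

end

section \<open>Geometric programs and convex problems\<close>

definition monomial_on :: "'v set \<Rightarrow> (('v \<Rightarrow> real) \<Rightarrow> real) \<Rightarrow> bool"
  where "monomial_on V f \<longleftrightarrow>
    (\<exists>c>0. \<exists>a :: 'v \<Rightarrow> real. \<forall>x \<in> V \<rightarrow>\<^sub>E {0<..}. f x = c * (\<Prod>v\<in>V. x v powr a v))"

definition posynomial_on :: "'v set \<Rightarrow> (('v \<Rightarrow> real) \<Rightarrow> real) \<Rightarrow> bool"
  where "posynomial_on V f \<longleftrightarrow>
    (\<exists>(n::nat) m. (\<forall>i<n. monomial_on V (m i)) \<and> (\<forall>x \<in> V \<rightarrow>\<^sub>E {0<..}. f x = (\<Sum>i<n. m i x)))"

(* A minimization problem.  A pair (f, g) in le_constraints stands for the constraint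
   f x \<le> g x, and a pair (f, g) in eq_constraints for f x = g x. *)
record 'v problem =
  prob_domain :: "('v \<Rightarrow> real) set"
  objective :: "('v \<Rightarrow> real) \<Rightarrow> real"
  le_constraints :: "((('v \<Rightarrow> real) \<Rightarrow> real) \<times> (('v \<Rightarrow> real) \<Rightarrow> real)) set"
  eq_constraints :: "((('v \<Rightarrow> real) \<Rightarrow> real) \<times> (('v \<Rightarrow> real) \<Rightarrow> real)) set"

definition feasible_set :: "'v problem \<Rightarrow> ('v \<Rightarrow> real) set"
  where "feasible_set P = {x \<in> prob_domain P.
    (\<forall>(f, g) \<in> le_constraints P. f x \<le> g x) \<and> (\<forall>(f, g) \<in> eq_constraints P. f x = g x)}"

definition geometric_program :: "'v set \<Rightarrow> 'v problem \<Rightarrow> bool"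
  where "geometric_program V P \<longleftrightarrow>
    finite V \<and> prob_domain P = (V \<rightarrow>\<^sub>E {0<..}) \<and>
    posynomial_on V (objective P) \<and>
    finite (le_constraints P) \<and>
    (\<forall>(f, g) \<in> le_constraints P. posynomial_on V f \<and> monomial_on V g) \<and>
    finite (eq_constraints P) \<and>
    (\<forall>(f, g) \<in> eq_constraints P. monomial_on V f \<and> monomial_on V g)"

definition convex_problem :: "'v problem \<Rightarrow> bool"
  where "convex_problem P \<longleftrightarrow>
    convex_on (prob_domain P) (objective P) \<and> convex (feasible_set P)"

definition log_point :: "'v set \<Rightarrow> ('v \<Rightarrow> real) \<Rightarrow> 'v \<Rightarrow> real"
  where "log_point V x = (\<lambda>v\<in>V. ln (x v))"

definition exp_point :: "'v set \<Rightarrow> ('v \<Rightarrow> real) \<Rightarrow> 'v \<Rightarrow> real"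
  where "exp_point V u = (\<lambda>v\<in>V. exp (u v))"

(* The problem in the new variables u v = ln (x v): every function of the problem is
   rewritten in terms of u by substituting x v = exp (u v). *)
definition log_transform :: "'v set \<Rightarrow> 'v problem \<Rightarrow> 'v problem"
  where "log_transform V P =
    \<lparr> prob_domain = log_point V ` prob_domain P,
      objective = objective P \<circ> exp_point V,
      le_constraints = (\<lambda>(f, g). (f \<circ> exp_point V, g \<circ> exp_point V)) ` le_constraints P,
      eq_constraints = (\<lambda>(f, g). (f \<circ> exp_point V, g \<circ> exp_point V)) ` eq_constraints P \<rparr>"

section \<open>The parameter-range minimization problem\<close>

(* Weight l j k p is the position of the entry w_{j,k}[p] of layer l, Bias l j k that of
   b_{j,k}; working with positions keeps equal parameter values apart. *)
datatype param = Weight nat nat nat nat | Bias nat nat nat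

definition layer_params :: "(nat \<Rightarrow> nat) \<Rightarrow> (nat \<Rightarrow> nat \<Rightarrow> nat) \<Rightarrow> nat \<Rightarrow> param set"
  where "layer_params d K l =
    {Weight l j k p | j k p. j \<in> {1..d l} \<and> k \<in> {1..K l j} \<and> p \<in> {1..d (l - 1)}} \<union>
    {Bias l j k | j k. j \<in> {1..d l} \<and> k \<in> {1..K l j}}"

fun param_value ::
  "(nat \<Rightarrow> nat \<Rightarrow> nat \<Rightarrow> nat \<Rightarrow> real) \<Rightarrow> (nat \<Rightarrow> nat \<Rightarrow> nat \<Rightarrow> real) \<Rightarrow> param \<Rightarrow> real"
  where
    "param_value w b (Weight l j k p) = w l j k p"
  | "param_value w b (Bias l j k) = b l j k"

(* The variables d_{l,i}, s_p and s_n of layer l, and t. *)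
datatype gp_var = Scale nat nat | SPos nat | SNeg nat | Total

definition gp_vars :: "nat \<Rightarrow> (nat \<Rightarrow> nat) \<Rightarrow> gp_var set"
  where "gp_vars L d =
    {Scale l i | l i. l \<in> {1..L-1} \<and> i \<in> {1..d l}} \<union>
    SPos ` {1..L-1} \<union> SNeg ` {1..L-1} \<union> {Total}"

(* Layer 0 is the input, which is not scaled. *)
definition scale :: "(gp_var \<Rightarrow> real) \<Rightarrow> nat \<Rightarrow> nat \<Rightarrow> real"
  where "scale x l i = (if l = 0 then 1 else x (Scale l i))"

definition scale_exponent ::
  "(nat \<Rightarrow> nat \<Rightarrow> nat \<Rightarrow> real) \<Rightarrow> (nat \<Rightarrow> real) \<Rightarrow> nat \<Rightarrow> nat \<Rightarrow> nat \<Rightarrow> real"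
  where "scale_exponent r \<alpha> l j k = 1 / (\<alpha> l * r l j k)"

fun param_factor ::
  "(nat \<Rightarrow> nat \<Rightarrow> nat \<Rightarrow> real) \<Rightarrow> (nat \<Rightarrow> real) \<Rightarrow> param \<Rightarrow> (gp_var \<Rightarrow> real) \<Rightarrow> real"
  where
    "param_factor r \<alpha> (Weight l j k p) x =
       inverse (scale x (l - 1) p) * scale x l j powr scale_exponent r \<alpha> l j k"
  | "param_factor r \<alpha> (Bias l j k) x = scale x l j powr scale_exponent r \<alpha> l j k"

(* The flags normalized and boxed select the two optional groups of constraints. *)
definition range_problem ::
  "bool \<Rightarrow> bool \<Rightarrow> real \<Rightarrow> real \<Rightarrow> nat \<Rightarrow> (nat \<Rightarrow> nat) \<Rightarrow> (nat \<Rightarrow> nat \<Rightarrow> nat) \<Rightarrow>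
   (nat \<Rightarrow> nat \<Rightarrow> nat \<Rightarrow> real) \<Rightarrow> (nat \<Rightarrow> real) \<Rightarrow>
   (nat \<Rightarrow> nat \<Rightarrow> nat \<Rightarrow> nat \<Rightarrow> real) \<Rightarrow> (nat \<Rightarrow> nat \<Rightarrow> nat \<Rightarrow> real) \<Rightarrow> gp_var problem"
  where "range_problem normalized boxed dmin dmax L d K r \<alpha> w b =
    \<lparr> prob_domain = gp_vars L d \<rightarrow>\<^sub>E {0<..},
      objective = (\<lambda>x. x Total),
      le_constraints =
        {(\<lambda>x. x (SPos l) + x (SNeg l), \<lambda>x. x Total) | l. l \<in> {1..L-1}} \<union>
        {(\<lambda>x. param_value w b a * param_factor r \<alpha> a x, \<lambda>x. x (SPos l)) | l a.
           l \<in> {1..L-1} \<and> a \<in> layer_params d K l \<and> param_value w b a \<ge> 0} \<union>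
        {(\<lambda>x. (- param_value w b a) * param_factor r \<alpha> a x, \<lambda>x. x (SNeg l)) | l a.
           l \<in> {1..L-1} \<and> a \<in> layer_params d K l \<and> param_value w b a < 0} \<union>
        (if boxed then
           {(\<lambda>x. dmin, \<lambda>x. x (Scale l i)) | l i. l \<in> {1..L-1} \<and> i \<in> {1..d l}} \<union>
           {(\<lambda>x. x (Scale l i), \<lambda>x. dmax) | l i. l \<in> {1..L-1} \<and> i \<in> {1..d l}}
         else {}),
      eq_constraints =
        (if normalized then {(\<lambda>x. \<Prod>i\<in>{1..d l}. x (Scale l i), \<lambda>x. 1) | l. l \<in> {1..L-1}} else {}) \<rparr>"

end

theory Submission
  imports Defs
begin

text \<open>
  A function is a monomial precisely when, in the variables \<open>u v = ln (x v)\<close>, it is the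
  exponential of an affine function (\<open>monomial_on_iff\<close>).  Hence quotients of monomials are again
  monomials, and a posynomial becomes a convex function of \<open>u\<close>, being a sum of exponentials of
  affine functions (\<open>convex_on_posynomial\<close>).  Dividing a constraint \<open>f x \<le> g x\<close> by the
  monomial \<open>g\<close> turns it into the sublevel set of a posynomial at height 1, and an equation
  between monomials is a pair of such inequalities; so the logarithmic image of any geometric
  program is a convex problem (\<open>convex_problem_log_transform\<close>).  The logarithm of the objective
  is not needed: the posynomial itself is already convex in \<open>u\<close>.

  It remains to see that the parameter-range problem is a geometric program.  Every factor
  \<open>\<Phi>\<^sub>a\<close> is a product of real powers of variables, so \<open>\<bar>a\<bar> \<Phi>\<^sub>a\<close> is a monomial for \<open>a \<noteq> 0\<close> and
  the empty posynomial for \<open>a = 0\<close>; all remaining expressions are visibly monomials or sums of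
  two monomials.
\<close>

section \<open>Monomials and posynomials\<close>

text \<open>The coefficient is absorbed into the exponent as \<open>\<beta> = ln c\<close>; this additive form makes the
  closure properties of monomials and their convexity linear statements about exponents.\<close>

lemma monomial_on_iff:
  fixes f :: "('v \<Rightarrow> real) \<Rightarrow> real"
  assumes "finite V"
  shows "monomial_on V f \<longleftrightarrow>
    (\<exists>\<beta> a. \<forall>x \<in> V \<rightarrow>\<^sub>E {0<..}. f x = exp (\<beta> + (\<Sum>v\<in>V. a v * ln (x v))))"
proof -
  have *: "exp \<beta> * (\<Prod>v\<in>V. x v powr a v) = exp (\<beta> + (\<Sum>v\<in>V. a v * ln (x v)))"
    if "x \<in> V \<rightarrow>\<^sub>E {0<..}" for \<beta> and a x :: "'v \<Rightarrow> real"
  proof -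
    have "(\<Prod>v\<in>V. x v powr a v) = (\<Prod>v\<in>V. exp (a v * ln (x v)))"
      using that by (intro prod.cong refl) (auto simp: powr_def PiE_def Pi_def)
    then show ?thesis
      using assms by (simp add: exp_add exp_sum)
  qed
  show ?thesis
  proof
    assume "monomial_on V f"
    then obtain c a where c: "c > 0"
      and f: "\<forall>x \<in> V \<rightarrow>\<^sub>E {0<..}. f x = c * (\<Prod>v\<in>V. x v powr a v)"
      unfolding monomial_on_def by blast
    have "\<forall>x \<in> V \<rightarrow>\<^sub>E {0<..}. f x = exp (ln c + (\<Sum>v\<in>V. a v * ln (x v)))"
      using c f *[of _ "ln c" a] by simp
    then show "\<exists>\<beta> a. \<forall>x \<in> V \<rightarrow>\<^sub>E {0<..}. f x = exp (\<beta> + (\<Sum>v\<in>V. a v * ln (x v)))"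
      by blast
  next
    assume "\<exists>\<beta> a. \<forall>x \<in> V \<rightarrow>\<^sub>E {0<..}. f x = exp (\<beta> + (\<Sum>v\<in>V. a v * ln (x v)))"
    then obtain \<beta> a where "\<forall>x \<in> V \<rightarrow>\<^sub>E {0<..}. f x = exp (\<beta> + (\<Sum>v\<in>V. a v * ln (x v)))"
      by blast
    then have "\<forall>x \<in> V \<rightarrow>\<^sub>E {0<..}. f x = exp \<beta> * (\<Prod>v\<in>V. x v powr a v)"
      by (simp add: *)
    then show "monomial_on V f"
      unfolding monomial_on_def by (intro exI[of _ "exp \<beta>"]) auto
  qed
qed

lemma monomial_on_pos:
  assumes "finite V" "monomial_on V f" "x \<in> V \<rightarrow>\<^sub>E {0<..}"
  shows "f x > 0"
  using assms by (auto simp: monomial_on_iff)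

lemma monomial_on_const:
  assumes "c > 0"
  shows "monomial_on V (\<lambda>x. c)"
  unfolding monomial_on_def
  by (intro exI[of _ c] conjI exI[of _ "\<lambda>_. 0"])
     (use assms in \<open>auto simp: PiE_def Pi_def less_imp_neq[symmetric] intro!: prod.neutral[symmetric]\<close>)

lemma monomial_on_variable:
  assumes "finite V" "v \<in> V"
  shows "monomial_on V (\<lambda>x. x v)"
  unfolding monomial_on_iff[OF assms(1)]
proof (intro exI ballI)
  fix x :: "'a \<Rightarrow> real"
  assume x: "x \<in> V \<rightarrow>\<^sub>E {0<..}"
  have "(\<Sum>u\<in>V. (if u = v then 1 else 0) * ln (x u)) = (\<Sum>u\<in>V. if u = v then ln (x u) else 0)"
    by (intro sum.cong) auto
  then show "x v = exp (0 + (\<Sum>u\<in>V. (if u = v then 1 else 0) * ln (x u)))"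
    using assms x by (auto simp: PiE_def Pi_def)
qed

lemma monomial_on_mult:
  assumes "finite V" "monomial_on V f" "monomial_on V g"
  shows "monomial_on V (\<lambda>x. f x * g x)"
proof -
  from assms obtain \<beta> a \<gamma> c where
    "\<forall>x \<in> V \<rightarrow>\<^sub>E {0<..}. f x = exp (\<beta> + (\<Sum>v\<in>V. a v * ln (x v)))"
    "\<forall>x \<in> V \<rightarrow>\<^sub>E {0<..}. g x = exp (\<gamma> + (\<Sum>v\<in>V. c v * ln (x v)))"
    unfolding monomial_on_iff[OF assms(1)] by blast
  then have "\<forall>x \<in> V \<rightarrow>\<^sub>E {0<..}.
      f x * g x = exp ((\<beta> + \<gamma>) + (\<Sum>v\<in>V. (a v + c v) * ln (x v)))"
    by (simp add: exp_add[symmetric] distrib_right sum.distrib add_ac)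
  then show ?thesis
    unfolding monomial_on_iff[OF assms(1)] by (intro exI)
qed

lemma monomial_on_powr:
  assumes "finite V" "monomial_on V f"
  shows "monomial_on V (\<lambda>x. f x powr p)"
proof -
  from assms obtain \<beta> a where
    "\<forall>x \<in> V \<rightarrow>\<^sub>E {0<..}. f x = exp (\<beta> + (\<Sum>v\<in>V. a v * ln (x v)))"
    unfolding monomial_on_iff[OF assms(1)] by blast
  then have "\<forall>x \<in> V \<rightarrow>\<^sub>E {0<..}.
      f x powr p = exp (p * \<beta> + (\<Sum>v\<in>V. (p * a v) * ln (x v)))"
    by (simp add: powr_def distrib_left sum_distrib_left mult_ac)
  then show ?thesis
    unfolding monomial_on_iff[OF assms(1)] by (intro exI)
qed

lemma monomial_on_cong:
  assumes "monomial_on V f" "\<And>x. x \<in> V \<rightarrow>\<^sub>E {0<..} \<Longrightarrow> g x = f x"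
  shows "monomial_on V g"
  using assms unfolding monomial_on_def by simp

lemma monomial_on_inverse:
  assumes "finite V" "monomial_on V f"
  shows "monomial_on V (\<lambda>x. inverse (f x))"
  by (rule monomial_on_cong[OF monomial_on_powr[OF assms, of "-1"]])
     (use monomial_on_pos[OF assms] in \<open>simp add: powr_minus less_imp_le\<close>)

lemma monomial_on_prod:
  assumes "finite V" "\<And>i. i \<in> I \<Longrightarrow> monomial_on V (f i)"
  shows "monomial_on V (\<lambda>x. \<Prod>i\<in>I. f i x)"
  using assms(2)
  by (induction I rule: infinite_finite_induct)
     (simp_all add: monomial_on_const monomial_on_mult assms(1))

lemma posynomial_on_zero: "posynomial_on V (\<lambda>x. 0)"
  unfolding posynomial_on_def by (intro exI[of _ 0]) simp

lemma posynomial_on_add_monomial: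
  assumes "posynomial_on V f" "monomial_on V g"
  shows "posynomial_on V (\<lambda>x. f x + g x)"
proof -
  from assms(1) obtain n :: nat and m where m: "\<forall>i<n. monomial_on V (m i)"
    "\<forall>x \<in> V \<rightarrow>\<^sub>E {0<..}. f x = (\<Sum>i<n. m i x)"
    unfolding posynomial_on_def by blast
  show ?thesis
    unfolding posynomial_on_def
    by (intro exI[of _ "Suc n"] exI[of _ "m(n := g)"]) (use m assms(2) in \<open>auto simp: less_Suc_eq\<close>)
qed

lemma posynomial_on_monomial: "monomial_on V f \<Longrightarrow> posynomial_on V f"
  using posynomial_on_add_monomial[OF posynomial_on_zero] by simp

lemma posynomial_on_divide_monomial:
  assumes "finite V" "posynomial_on V f" "monomial_on V g"
  shows "posynomial_on V (\<lambda>x. f x * inverse (g x))"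
proof -
  from assms(2) obtain n :: nat and m where m: "\<forall>i<n. monomial_on V (m i)"
    "\<forall>x \<in> V \<rightarrow>\<^sub>E {0<..}. f x = (\<Sum>i<n. m i x)"
    unfolding posynomial_on_def by blast
  have "\<forall>i<n. monomial_on V (\<lambda>x. m i x * inverse (g x))"
    using m(1) assms by (auto intro: monomial_on_mult monomial_on_inverse)
  moreover have "\<forall>x \<in> V \<rightarrow>\<^sub>E {0<..}. f x * inverse (g x) = (\<Sum>i<n. m i x * inverse (g x))"
    using m(2) by (simp add: sum_distrib_right)
  ultimately show ?thesis
    unfolding posynomial_on_def by (intro exI conjI)
qed

section \<open>Convexity in logarithmic variables\<close>

text \<open>At an index outside \<open>V\<close> both points have the value \<open>undefined\<close>, and so does any convex
  combination of them because its weights add up to 1.\<close>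

lemma convex_PiE_UNIV: "convex (V \<rightarrow>\<^sub>E (UNIV :: real set))"
proof (rule convexI)
  fix x y :: "'a \<Rightarrow> real" and s t :: real
  assume "x \<in> V \<rightarrow>\<^sub>E UNIV" "y \<in> V \<rightarrow>\<^sub>E UNIV" and st: "s + t = 1"
  have "s * undefined + t * undefined = (undefined :: real)"
    by (simp only: st mult_1 flip: distrib_right)
  with \<open>x \<in> V \<rightarrow>\<^sub>E UNIV\<close> \<open>y \<in> V \<rightarrow>\<^sub>E UNIV\<close> show "s *\<^sub>R x + t *\<^sub>R y \<in> V \<rightarrow>\<^sub>E UNIV"
    by (simp add: PiE_iff extensional_def scaleR_fun_def plus_fun_def)
qed

lemma exp_point_in_PiE: "exp_point V u \<in> V \<rightarrow>\<^sub>E {0<..}"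
  by (auto simp: exp_point_def)

lemma log_point_image: "log_point V ` (V \<rightarrow>\<^sub>E {0<..}) = V \<rightarrow>\<^sub>E UNIV"
proof (intro equalityI subsetI)
  fix u :: "'a \<Rightarrow> real"
  assume u: "u \<in> V \<rightarrow>\<^sub>E UNIV"
  have "u = log_point V (exp_point V u)"
  proof
    fix v
    show "u v = log_point V (exp_point V u) v"
      using u by (auto simp: log_point_def exp_point_def PiE_def extensional_def)
  qed
  then show "u \<in> log_point V ` (V \<rightarrow>\<^sub>E {0<..})"
    by (rule image_eqI[OF _ exp_point_in_PiE])
qed (auto simp: log_point_def)

lemma convex_on_monomial:
  assumes "finite V" "monomial_on V f"
  shows "convex_on (V \<rightarrow>\<^sub>E UNIV) (f \<circ> exp_point V)"
proof -
  from assms obtain \<beta> a where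
    f: "\<forall>x \<in> V \<rightarrow>\<^sub>E {0<..}. f x = exp (\<beta> + (\<Sum>v\<in>V. a v * ln (x v)))"
    unfolding monomial_on_iff[OF assms(1)] by blast
  define h where "h u = \<beta> + (\<Sum>v\<in>V. a v * u v)" for u :: "'a \<Rightarrow> real"
  have fh: "f (exp_point V u) = exp (h u)" for u
    using f exp_point_in_PiE by (auto simp: h_def exp_point_def)
  have affine: "h ((1 - t) *\<^sub>R u + t *\<^sub>R v) = (1 - t) * h u + t * h v" for t u v
    by (simp add: h_def scaleR_fun_def plus_fun_def algebra_simps sum.distrib
        sum_subtractf sum_distrib_left)
  show ?thesis
  proof (rule convex_onI)
    fix t :: real and u v :: "'a \<Rightarrow> real"
    assume "0 < t" "t < 1"
    then show "(f \<circ> exp_point V) ((1 - t) *\<^sub>R u + t *\<^sub>R v)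
        \<le> (1 - t) * (f \<circ> exp_point V) u + t * (f \<circ> exp_point V) v"
      using convex_onD[OF exp_convex, of t "h u" "h v"] by (simp add: fh affine)
  qed (rule convex_PiE_UNIV)
qed

lemma convex_on_posynomial:
  assumes "finite V" "posynomial_on V f"
  shows "convex_on (V \<rightarrow>\<^sub>E UNIV) (f \<circ> exp_point V)"
proof -
  from assms(2) obtain n :: nat and m where m: "\<forall>i<n. monomial_on V (m i)"
    "\<forall>x \<in> V \<rightarrow>\<^sub>E {0<..}. f x = (\<Sum>i<n. m i x)"
    unfolding posynomial_on_def by blast
  have "convex_on (V \<rightarrow>\<^sub>E UNIV) (\<lambda>u. \<Sum>i<k. (m i \<circ> exp_point V) u)" if "k \<le> n" for k
    using that
  proof (induction k)
    case 0
    then show ?case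
      by (simp add: convex_on_const convex_PiE_UNIV)
  next
    case (Suc k)
    then show ?case
      using convex_on_add[of "V \<rightarrow>\<^sub>E UNIV" _ "m k \<circ> exp_point V"] convex_on_monomial[OF assms(1)] m(1)
      by simp
  qed
  moreover have "f \<circ> exp_point V = (\<lambda>u. \<Sum>i<n. (m i \<circ> exp_point V) u)"
    using m(2)[rule_format, OF exp_point_in_PiE] by (simp add: fun_eq_iff)
  ultimately show ?thesis
    by simp
qed

lemma convex_posynomial_le_monomial:
  assumes "finite V" "posynomial_on V f" "monomial_on V g"
  shows "convex {u \<in> V \<rightarrow>\<^sub>E UNIV. f (exp_point V u) \<le> g (exp_point V u)}"
proof -
  let ?h = "(\<lambda>x. f x * inverse (g x)) \<circ> exp_point V"
  have h: "convex_on (V \<rightarrow>\<^sub>E UNIV) ?h"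
    by (intro convex_on_posynomial posynomial_on_divide_monomial assms)
  have "f (exp_point V u) \<le> g (exp_point V u) \<longleftrightarrow> ?h u \<le> 1" for u
    using monomial_on_pos[OF assms(1,3) exp_point_in_PiE, of u] by (simp add: field_simps)
  moreover have "convex {u \<in> V \<rightarrow>\<^sub>E UNIV. ?h u \<le> 1}"
  proof (rule convexI)
    fix u v :: "'a \<Rightarrow> real" and s t :: real
    assume u: "u \<in> {u \<in> V \<rightarrow>\<^sub>E UNIV. ?h u \<le> 1}" and v: "v \<in> {u \<in> V \<rightarrow>\<^sub>E UNIV. ?h u \<le> 1}"
      and st: "0 \<le> s" "0 \<le> t" "s + t = 1"
    have "?h (s *\<^sub>R u + t *\<^sub>R v) \<le> max (?h u) (?h v)"
      using u v st by (intro convex_lower[OF h]) (simp_all only: mem_Collect_eq)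
    also have "\<dots> \<le> 1"
      using u v by simp
    finally have "?h (s *\<^sub>R u + t *\<^sub>R v) \<le> 1" .
    moreover have "s *\<^sub>R u + t *\<^sub>R v \<in> V \<rightarrow>\<^sub>E UNIV"
      by (rule convexD[OF convex_PiE_UNIV CollectD[OF u, THEN conjunct1]
            CollectD[OF v, THEN conjunct1] st])
    ultimately show "s *\<^sub>R u + t *\<^sub>R v \<in> {u \<in> V \<rightarrow>\<^sub>E UNIV. ?h u \<le> 1}"
      by (intro CollectI conjI)
  qed
  ultimately show ?thesis
    by simp
qed

theorem convex_problem_log_transform:
  assumes "geometric_program V P"
  shows "convex_problem (log_transform V P)"
proof -
  note gp = assms[unfolded geometric_program_def]
  have V: "finite V"
    using gp by blast
  have dom: "prob_domain (log_transform V P) = V \<rightarrow>\<^sub>E UNIV"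
    using gp by (simp add: log_transform_def log_point_image)
  define C where "C = (\<lambda>(f, g). {u \<in> V \<rightarrow>\<^sub>E UNIV. f (exp_point V u) \<le> (g (exp_point V u) :: real)})"
  have C: "convex (C (f, g))" if "posynomial_on V f" "monomial_on V g" for f g
    using convex_posynomial_le_monomial[OF V that] by (simp add: C_def)
  \<comment> \<open>An equation contributes both of its inequalities; the domain is listed separately so that
    the intersection is also correct when there are no constraints.\<close>
  have "feasible_set (log_transform V P) =
      (V \<rightarrow>\<^sub>E UNIV) \<inter> (\<Inter>p\<in>le_constraints P. C p) \<inter>
      (\<Inter>p\<in>eq_constraints P. C p \<inter> C (prod.swap p))"
    unfolding feasible_set_def dom by (fastforce simp: log_transform_def C_def)
  also have "convex \<dots>"
    using gp by (intro convex_Int convex_INT convex_PiE_UNIV)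
      (fastforce intro: C posynomial_on_monomial)+
  finally have "convex (feasible_set (log_transform V P))" .
  moreover have "convex_on (prob_domain (log_transform V P)) (objective (log_transform V P))"
    using gp convex_on_posynomial[OF V, of "objective P"] by (simp add: dom) (simp add: log_transform_def)
  ultimately show ?thesis
    by (simp add: convex_problem_def)
qed

section \<open>The parameter-range problem is a geometric program\<close>

lemma finite_gp_vars: "finite (gp_vars L d)"
proof -
  have "{Scale l i | l i. l \<in> {1..L-1} \<and> i \<in> {1..d l}} =
      (\<lambda>(l, i). Scale l i) ` (SIGMA l:{1..L-1}. {1..d l})"
    by auto
  then show ?thesis
    by (simp add: gp_vars_def)
qed

lemma finite_layer_params: "finite (layer_params d K l)"
proof -
  have "layer_params d K l =
      (\<lambda>(j, k, p). Weight l j k p) ` (SIGMA j:{1..d l}. {1..K l j} \<times> {1..d (l - 1)}) \<union>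
      (\<lambda>(j, k). Bias l j k) ` (SIGMA j:{1..d l}. {1..K l j})"
    by (force simp: layer_params_def)
  then show ?thesis
    by simp
qed

lemma monomial_on_scale:
  assumes "l \<le> L - 1" "i \<in> {1..d l}"
  shows "monomial_on (gp_vars L d) (\<lambda>x. scale x l i)"
proof (cases "l = 0")
  case True
  then show ?thesis
    by (simp add: scale_def monomial_on_const)
next
  case False
  then show ?thesis
    using assms monomial_on_variable[OF finite_gp_vars, of "Scale l i" L d]
    by (auto simp: scale_def gp_vars_def)
qed

lemma monomial_on_param_factor:
  assumes "l \<in> {1..L-1}" "a \<in> layer_params d K l"
  shows "monomial_on (gp_vars L d) (param_factor r \<alpha> a)"
proof -
  note mono = monomial_on_mult[OF finite_gp_vars] monomial_on_inverse[OF finite_gp_vars]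
    monomial_on_powr[OF finite_gp_vars] monomial_on_scale
  consider (weight) j k p where "a = Weight l j k p" "j \<in> {1..d l}" "p \<in> {1..d (l - 1)}"
    | (bias) j k where "a = Bias l j k" "j \<in> {1..d l}"
    using assms(2) unfolding layer_params_def by blast
  then show ?thesis
  proof cases
    case weight
    have "monomial_on (gp_vars L d)
        (\<lambda>x. inverse (scale x (l - 1) p) * scale x l j powr scale_exponent r \<alpha> l j k)"
      using assms(1) weight by (intro mono) auto
    then show ?thesis
      by (rule monomial_on_cong) (simp add: weight)
  next
    case bias
    have "monomial_on (gp_vars L d) (\<lambda>x. scale x l j powr scale_exponent r \<alpha> l j k)"
      using assms(1) bias by (intro mono) auto
    then show ?thesis
      by (rule monomial_on_cong) (simp add: bias)
  qed
qed

lemma posynomial_on_const_mult_monomial: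
  assumes "finite V" "c \<ge> 0" "monomial_on V f"
  shows "posynomial_on V (\<lambda>x. c * f x)"
proof (cases "c = 0")
  case True
  then show ?thesis
    by (simp add: posynomial_on_zero)
next
  case False
  then show ?thesis
    using assms by (intro posynomial_on_monomial monomial_on_mult monomial_on_const) auto
qed

lemma finite_param_constraints:
  "finite {F l a | l a. l \<in> {1..L-1} \<and> a \<in> layer_params d K l \<and> Q a}"
proof (rule finite_subset)
  show "{F l a | l a. l \<in> {1..L-1} \<and> a \<in> layer_params d K l \<and> Q a} \<subseteq>
      (\<lambda>(l, a). F l a) ` (SIGMA l:{1..L-1}. layer_params d K l)"
    by auto
qed (simp add: finite_layer_params)

lemma finite_scale_constraints:
  "finite {F l i | l i. l \<in> {1..L-1} \<and> i \<in> {1..d l}}" for d :: "nat \<Rightarrow> nat"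
proof (rule finite_subset)
  show "{F l i | l i. l \<in> {1..L-1} \<and> i \<in> {1..d l}} \<subseteq>
      (\<lambda>(l, i). F l i) ` (SIGMA l:{1..L-1}. {1..d l})"
    by auto
qed simp

theorem geometric_program_range_problem:
  assumes "0 < dmin" "dmin \<le> dmax"
  shows "geometric_program (gp_vars L d) (range_problem normalized boxed dmin dmax L d K r \<alpha> w b)"
    (is "geometric_program ?V ?P")
proof -
  note V = finite_gp_vars
  have total: "monomial_on ?V (\<lambda>x. x Total)"
    by (rule monomial_on_variable[OF V]) (simp add: gp_vars_def)
  have spos: "monomial_on ?V (\<lambda>x. x (SPos l))" if "l \<in> {1..L-1}" for l
    by (rule monomial_on_variable[OF V]) (use that in \<open>auto simp: gp_vars_def\<close>)
  have sneg: "monomial_on ?V (\<lambda>x. x (SNeg l))" if "l \<in> {1..L-1}" for l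
    by (rule monomial_on_variable[OF V]) (use that in \<open>auto simp: gp_vars_def\<close>)
  have scale: "monomial_on ?V (\<lambda>x. x (Scale l i))" if "l \<in> {1..L-1}" "i \<in> {1..d l}" for l i
    by (rule monomial_on_variable[OF V]) (use that in \<open>auto simp: gp_vars_def\<close>)
  have sum: "posynomial_on ?V (\<lambda>x. x (SPos l) + x (SNeg l))" if "l \<in> {1..L-1}" for l
    using that by (intro posynomial_on_add_monomial posynomial_on_monomial spos sneg)
  have range: "posynomial_on ?V (\<lambda>x. c * param_factor r \<alpha> a x)"
    if "l \<in> {1..L-1}" "a \<in> layer_params d K l" "c \<ge> 0" for l a c
    using that by (intro posynomial_on_const_mult_monomial V monomial_on_param_factor)
  have norm: "monomial_on ?V (\<lambda>x. \<Prod>i\<in>{1..d l}. x (Scale l i))" if "l \<in> {1..L-1}" for l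
    using that by (intro monomial_on_prod V scale)
  have const: "monomial_on ?V (\<lambda>x. dmin)" "monomial_on ?V (\<lambda>x. dmax)" "monomial_on ?V (\<lambda>x. 1)"
    using assms by (auto intro: monomial_on_const)
  have "finite (le_constraints ?P)"
    unfolding range_problem_def problem.simps
    by (cases boxed; simp only: if_True if_False)
       (intro finite_UnI finite_param_constraints finite_scale_constraints finite_image_set; simp)+
  moreover have "finite (eq_constraints ?P)"
    by (simp add: range_problem_def)
  moreover have "posynomial_on ?V f \<and> monomial_on ?V g" if fg: "(f, g) \<in> le_constraints ?P" for f g
  proof -
    consider (total) l where "l \<in> {1..L-1}"
        "f = (\<lambda>x. x (SPos l) + x (SNeg l))" "g = (\<lambda>x. x Total)"
      | (pos) l a where "l \<in> {1..L-1}" "a \<in> layer_params d K l" "param_value w b a \<ge> 0"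
        "f = (\<lambda>x. param_value w b a * param_factor r \<alpha> a x)" "g = (\<lambda>x. x (SPos l))"
      | (neg) l a where "l \<in> {1..L-1}" "a \<in> layer_params d K l" "param_value w b a < 0"
        "f = (\<lambda>x. (- param_value w b a) * param_factor r \<alpha> a x)" "g = (\<lambda>x. x (SNeg l))"
      | (lower) l i where "l \<in> {1..L-1}" "i \<in> {1..d l}" "f = (\<lambda>x. dmin)" "g = (\<lambda>x. x (Scale l i))"
      | (upper) l i where "l \<in> {1..L-1}" "i \<in> {1..d l}" "f = (\<lambda>x. x (Scale l i))" "g = (\<lambda>x. dmax)"
      using fg unfolding range_problem_def problem.simps
      by (auto split: if_splits simp del: atLeastAtMost_iff)
    then show ?thesis
    proof cases
      case total
      then show ?thesis using sum \<open>monomial_on ?V (\<lambda>x. x Total)\<close> by simp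
    next
      case pos
      then show ?thesis using range spos by simp
    next
      case neg
      then show ?thesis using range[of l a "- param_value w b a"] sneg by simp
    next
      case lower
      then show ?thesis using const scale by (simp add: posynomial_on_monomial)
    next
      case upper
      then show ?thesis using const scale by (simp add: posynomial_on_monomial)
    qed
  qed
  moreover have "monomial_on ?V f \<and> monomial_on ?V g" if "(f, g) \<in> eq_constraints ?P" for f g
    using that norm const by (auto simp: range_problem_def split: if_splits)
  moreover have "posynomial_on ?V (objective ?P)"
    using total by (simp add: range_problem_def posynomial_on_monomial)
  moreover have "prob_domain ?P = ?V \<rightarrow>\<^sub>E {0<..}"
    by (simp add: range_problem_def)
  ultimately show ?thesis
    unfolding geometric_program_def using V by blast
qed

theorem mainTheorem3:
  fixes L :: nat and d :: "nat \<Rightarrow> nat" and K :: "nat \<Rightarrow> nat \<Rightarrow> nat"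
    and r :: "nat \<Rightarrow> nat \<Rightarrow> nat \<Rightarrow> real" and \<alpha> :: "nat \<Rightarrow> real"
    and w :: "nat \<Rightarrow> nat \<Rightarrow> nat \<Rightarrow> nat \<Rightarrow> real" and b :: "nat \<Rightarrow> nat \<Rightarrow> nat \<Rightarrow> real"
    and dmin dmax :: real and normalized boxed :: bool
  assumes "L \<ge> 2"
    and "\<And>l j. l \<in> {1..L-1} \<Longrightarrow> j \<in> {1..d l} \<Longrightarrow> K l j \<ge> 1"
    and "\<And>l j k. l \<in> {1..L-1} \<Longrightarrow> j \<in> {1..d l} \<Longrightarrow> k \<in> {1..K l j} \<Longrightarrow> r l j k \<ge> 1"
    and "\<And>l. l \<in> {1..L-1} \<Longrightarrow> \<alpha> l > 0"
    and "0 < dmin" and "dmin \<le> dmax"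
  shows "geometric_program (gp_vars L d) (range_problem normalized boxed dmin dmax L d K r \<alpha> w b) \<and>
    convex_problem (log_transform (gp_vars L d) (range_problem normalized boxed dmin dmax L d K r \<alpha> w b))"
  using geometric_program_range_problem[OF assms(5,6)]
  by (blast intro: convex_problem_log_transform)

end
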